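(* Let $G$ be a finite solvable group, let $K$ be a subgroup of $G$ with $G' \leq K \leq G$, and let $A$ be the subgroup of $\operatorname{Inn}(G)$ consisting of the conjugations by elements of $K$. Then $\lambda(H,G)=\mu_A(H,G)$ for every subgroup $H\leq G$.
   Context: The Möbius function of a finite poset $P$ is the map $\mu_P:P\times P\to\mathbb Z$ with $\mu_P(x,y)=0$ unless $x\leq y$, $\mu_P(x,x)=1$, and $\sum_{x\leq z\leq y}\mu_P(x,z)=0$ for $x<y$. For a finite group $G$ and $A\leq \operatorname{Aut}(G)$, let $[H]_A=\{H^a\mid a\in A\}$ for $H\leq G$, and let $\mathcal C_A(G)$ be the set of all $[H]_A$, $H\le G$, partially ordered by: $[H]_A\leq [K]_A$ if $H^a\leq K$ for some $a\in A$. Let $\mu_A$ be the Möbius function of the poset $\mathcal C_A(G)$ and write $\mu_A(H,K)=\mu_A([H]_A,[K]_A)$. When $A=\operatorname{Inn}(G)$ one writes $\lambda=\mu_{\operatorname{Inn}(G)}$. $G'$ is the derived subgroup of $G$. *)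

theory Defs
  imports "HOL-Algebra.Algebra"
begin

section \<open>The Moebius function of a finite poset\<close>

text \<open>Posets are records of type \<^typ>\<open>'p gorder\<close> satisfying \<^locale>\<open>partial_order\<close>.\<close>

definition is_moebius :: "('p, 'c) gorder_scheme \<Rightarrow> ('p \<Rightarrow> 'p \<Rightarrow> int) \<Rightarrow> bool" where
  "is_moebius P m \<longleftrightarrow>
     (\<forall>x\<in>carrier P. \<forall>y\<in>carrier P. \<not> x \<sqsubseteq>\<^bsub>P\<^esub> y \<longrightarrow> m x y = 0) \<and>
     (\<forall>x\<in>carrier P. m x x = 1) \<and>
     (\<forall>x\<in>carrier P. \<forall>y\<in>carrier P. x \<sqsubset>\<^bsub>P\<^esub> y \<longrightarrow>
        (\<Sum>z | z \<in> carrier P \<and> x \<sqsubseteq>\<^bsub>P\<^esub> z \<and> z \<sqsubseteq>\<^bsub>P\<^esub> y. m x z) = 0)"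

text \<open>The first conjunct only fixes the junk values outside the carrier, so that the description
  is definite; see \<open>moebius_ex1\<close>.\<close>

definition moebius :: "('p, 'c) gorder_scheme \<Rightarrow> 'p \<Rightarrow> 'p \<Rightarrow> int" where
  "moebius P = (THE m. (\<forall>x y. x \<notin> carrier P \<or> y \<notin> carrier P \<longrightarrow> m x y = 0) \<and> is_moebius P m)"

lemma wf_strict_order:
  assumes "partial_order P" "finite (carrier P)"
  shows "wf {(z, y). z \<in> carrier P \<and> y \<in> carrier P \<and> z \<sqsubset>\<^bsub>P\<^esub> y}" (is "wf ?R")
proof -
  interpret partial_order P by fact
  have "?R \<subseteq> measure (\<lambda>y. card {u \<in> carrier P. u \<sqsubseteq>\<^bsub>P\<^esub> y})"
  proof clarsimp
    fix z y assume *: "z \<in> carrier P" "y \<in> carrier P" "z \<sqsubset>\<^bsub>P\<^esub> y"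
    then have le: "z \<sqsubseteq>\<^bsub>P\<^esub> y" and ne: "z \<noteq> y" by (auto simp: lless_def eq_is_equal)
    have "{u \<in> carrier P. u \<sqsubseteq>\<^bsub>P\<^esub> z} \<subseteq> {u \<in> carrier P. u \<sqsubseteq>\<^bsub>P\<^esub> y}"
      using * le le_trans by blast
    moreover have "y \<in> {u \<in> carrier P. u \<sqsubseteq>\<^bsub>P\<^esub> y}" "y \<notin> {u \<in> carrier P. u \<sqsubseteq>\<^bsub>P\<^esub> z}"
      using * le ne le_antisym by auto
    ultimately have "{u \<in> carrier P. u \<sqsubseteq>\<^bsub>P\<^esub> z} \<subset> {u \<in> carrier P. u \<sqsubseteq>\<^bsub>P\<^esub> y}" by blast
    then show "card {u \<in> carrier P. u \<sqsubseteq>\<^bsub>P\<^esub> z} < card {u \<in> carrier P. u \<sqsubseteq>\<^bsub>P\<^esub> y}"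
      using assms(2) by (intro psubset_card_mono) auto
  qed
  then show ?thesis using wf_subset wf_measure by blast
qed

lemma interval_split:
  assumes "partial_order P" "finite (carrier P)" "x \<in> carrier P" "y \<in> carrier P" "x \<sqsubset>\<^bsub>P\<^esub> y"
  shows "(\<Sum>z | z \<in> carrier P \<and> x \<sqsubseteq>\<^bsub>P\<^esub> z \<and> z \<sqsubseteq>\<^bsub>P\<^esub> y. f z) =
    (f y :: int) + (\<Sum>z | z \<in> carrier P \<and> x \<sqsubseteq>\<^bsub>P\<^esub> z \<and> z \<sqsubset>\<^bsub>P\<^esub> y. f z)"
proof -
  interpret partial_order P by fact
  have "{z. z \<in> carrier P \<and> x \<sqsubseteq>\<^bsub>P\<^esub> z \<and> z \<sqsubseteq>\<^bsub>P\<^esub> y} =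
      insert y {z. z \<in> carrier P \<and> x \<sqsubseteq>\<^bsub>P\<^esub> z \<and> z \<sqsubset>\<^bsub>P\<^esub> y}"
    using assms(3-5) by (auto simp: lless_def eq_is_equal)
  moreover have "y \<notin> {z. z \<in> carrier P \<and> x \<sqsubseteq>\<^bsub>P\<^esub> z \<and> z \<sqsubset>\<^bsub>P\<^esub> y}"
    by (auto simp: lless_def eq_is_equal)
  ultimately show ?thesis using assms(2) by simp
qed

lemma moebius_ex1:
  assumes "partial_order P" "finite (carrier P)"
  shows "\<exists>!m. (\<forall>x y. x \<notin> carrier P \<or> y \<notin> carrier P \<longrightarrow> m x y = 0) \<and> is_moebius P m"
proof (rule ex_ex1I)
  interpret partial_order P by fact
  define R where "R = {(z, y). z \<in> carrier P \<and> y \<in> carrier P \<and> z \<sqsubset>\<^bsub>P\<^esub> y}"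
  define F where "F = (\<lambda>x f y. if x \<notin> carrier P \<or> y \<notin> carrier P \<or> \<not> x \<sqsubseteq>\<^bsub>P\<^esub> y then 0
     else if x = y then 1
     else - (\<Sum>z | z \<in> carrier P \<and> x \<sqsubseteq>\<^bsub>P\<^esub> z \<and> z \<sqsubset>\<^bsub>P\<^esub> y. f z) :: int)"
  define m where "m = (\<lambda>x. wfrec R (F x))"
  have wf: "wf R" using wf_strict_order[OF assms] by (simp add: R_def)
  have "F x (cut (m x) R y) y = F x (m x) y" for x y
    by (auto simp: F_def R_def cut_apply intro!: sum.cong)
  then have m: "m x y = F x (m x) y" for x y
    using wfrec[OF wf, of "F x" y] by (simp add: m_def)
  have "is_moebius P m"
    unfolding is_moebius_def
  proof (intro conjI ballI impI)
    fix x y assume "x \<in> carrier P" "y \<in> carrier P" "\<not> x \<sqsubseteq>\<^bsub>P\<^esub> y"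
    then show "m x y = 0" using m[of x y] by (simp add: F_def)
  next
    fix x assume "x \<in> carrier P"
    then show "m x x = 1" using m[of x x] by (simp add: F_def)
  next
    fix x y assume *: "x \<in> carrier P" "y \<in> carrier P" "x \<sqsubset>\<^bsub>P\<^esub> y"
    then have "x \<sqsubseteq>\<^bsub>P\<^esub> y" "x \<noteq> y" by (auto simp: lless_def eq_is_equal)
    then show "(\<Sum>z | z \<in> carrier P \<and> x \<sqsubseteq>\<^bsub>P\<^esub> z \<and> z \<sqsubseteq>\<^bsub>P\<^esub> y. m x z) = 0"
      unfolding interval_split[OF assms *] using m[of x y] * by (simp add: F_def)
  qed
  moreover have "m x y = 0" if "x \<notin> carrier P \<or> y \<notin> carrier P" for x y
    using m[of x y] that by (auto simp: F_def)
  ultimately show "\<exists>m. (\<forall>x y. x \<notin> carrier P \<or> y \<notin> carrier P \<longrightarrow> m x y = 0) \<and> is_moebius P m"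
    by blast
next
  interpret partial_order P by fact
  fix m m' :: "'a \<Rightarrow> 'a \<Rightarrow> int"
  assume m: "(\<forall>x y. x \<notin> carrier P \<or> y \<notin> carrier P \<longrightarrow> m x y = 0) \<and> is_moebius P m"
    and m': "(\<forall>x y. x \<notin> carrier P \<or> y \<notin> carrier P \<longrightarrow> m' x y = 0) \<and> is_moebius P m'"
  have "m x y = m' x y" for x y
  proof (induction y rule: wf_induct_rule[OF wf_strict_order[OF assms]])
    case (1 y)
    consider "x \<notin> carrier P \<or> y \<notin> carrier P"
      | "x \<in> carrier P" "y \<in> carrier P" "\<not> x \<sqsubseteq>\<^bsub>P\<^esub> y"
      | "x \<in> carrier P" "y = x"
      | "x \<in> carrier P" "y \<in> carrier P" "x \<sqsubset>\<^bsub>P\<^esub> y"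
      by (auto simp: lless_def eq_is_equal)
    then show ?case
    proof cases
      case 4
      have "(\<Sum>z | z \<in> carrier P \<and> x \<sqsubseteq>\<^bsub>P\<^esub> z \<and> z \<sqsubset>\<^bsub>P\<^esub> y. m x z) =
          (\<Sum>z | z \<in> carrier P \<and> x \<sqsubseteq>\<^bsub>P\<^esub> z \<and> z \<sqsubset>\<^bsub>P\<^esub> y. m' x z)"
        using 1 4 by (intro sum.cong) auto
      moreover have "m x y + (\<Sum>z | z \<in> carrier P \<and> x \<sqsubseteq>\<^bsub>P\<^esub> z \<and> z \<sqsubset>\<^bsub>P\<^esub> y. m x z) = 0"
        using m 4 interval_split[OF assms 4, of "m x"] by (simp add: is_moebius_def)
      moreover have "m' x y + (\<Sum>z | z \<in> carrier P \<and> x \<sqsubseteq>\<^bsub>P\<^esub> z \<and> z \<sqsubset>\<^bsub>P\<^esub> y. m' x z) = 0"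
        using m' 4 interval_split[OF assms 4, of "m' x"] by (simp add: is_moebius_def)
      ultimately show ?thesis by simp
    qed (use m m' in \<open>auto simp: is_moebius_def\<close>)
  qed
  then show "m = m'" by blast
qed

lemma is_moebius_moebius:
  assumes "partial_order P" "finite (carrier P)"
  shows "is_moebius P (moebius P)"
  using theI'[OF moebius_ex1[OF assms]] by (simp add: moebius_def)


section \<open>The poset of classes of subgroups under a group of automorphisms\<close>

definition aut_class :: "('a \<Rightarrow> 'a) set \<Rightarrow> 'a set \<Rightarrow> 'a set set" where
  "aut_class A H = {a ` H | a. a \<in> A}"

text \<open>For a group \<open>A\<close> of automorphisms of a finite group this is a finite partial order whose
  relation does not depend on the chosen representatives: \<open>class_poset_le_iff\<close>,
  \<open>partial_order_class_poset\<close>, \<open>finite_class_poset\<close> below.\<close>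

definition class_poset :: "('a \<Rightarrow> 'a) set \<Rightarrow> ('a, 'b) monoid_scheme \<Rightarrow> 'a set set gorder" where
  "class_poset A G =
    \<lparr>carrier = {aut_class A H | H. subgroup H G},
     eq = (=),
     le = (\<lambda>S T. \<exists>H K. subgroup H G \<and> subgroup K G \<and> S = aut_class A H \<and> T = aut_class A K \<and>
            (\<exists>a\<in>A. a ` H \<subseteq> K))\<rparr>"

definition mu :: "('a \<Rightarrow> 'a) set \<Rightarrow> ('a, 'b) monoid_scheme \<Rightarrow> 'a set \<Rightarrow> 'a set \<Rightarrow> int" where
  "mu A G H K = moebius (class_poset A G) (aut_class A H) (aut_class A K)"

text \<open>Right action \<open>x\<^sup>g = g\<^sup>-\<^sup>1 x g\<close>, restricted to the carrier like the members of
  \<^const>\<open>auto\<close>.\<close>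

definition conj_aut :: "('a, 'b) monoid_scheme \<Rightarrow> 'a \<Rightarrow> 'a \<Rightarrow> 'a" where
  "conj_aut G g = (\<lambda>x \<in> carrier G. inv\<^bsub>G\<^esub> g \<otimes>\<^bsub>G\<^esub> x \<otimes>\<^bsub>G\<^esub> g)"

definition Inn :: "('a, 'b) monoid_scheme \<Rightarrow> ('a \<Rightarrow> 'a) set" where
  "Inn G = conj_aut G ` carrier G"

definition lam :: "('a, 'b) monoid_scheme \<Rightarrow> 'a set \<Rightarrow> 'a set \<Rightarrow> int" where
  "lam G H K = mu (Inn G) G H K"

context group
begin

lemma aut_subgroup_facts:
  assumes A: "subgroup A (AutoGroup G)"
  shows "a \<in> A \<Longrightarrow> a \<in> auto G"
    and "H \<subseteq> carrier G \<Longrightarrow> \<exists>e\<in>A. e ` H = H"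
    and "a \<in> A \<Longrightarrow> b \<in> A \<Longrightarrow> H \<subseteq> carrier G \<Longrightarrow> \<exists>c\<in>A. c ` H = b ` a ` H"
    and "a \<in> A \<Longrightarrow> H \<subseteq> carrier G \<Longrightarrow> \<exists>c\<in>A. c ` a ` H = H"
proof -
  show sub: "a \<in> auto G" if "a \<in> A" for a
    using subgroup.subset[OF A] that by (auto simp: AutoGroup_def)
  then have Bij: "a \<in> Bij (carrier G)" if "a \<in> A" for a
    using that by (auto simp: auto_def)
  have "\<one>\<^bsub>AutoGroup G\<^esub> \<in> A" by (rule subgroup.one_closed[OF A])
  then show "\<exists>e\<in>A. e ` H = H" if "H \<subseteq> carrier G" for H
    using that
    by (intro bexI) (auto simp: AutoGroup_def BijGroup_def image_iff subset_iff)
  have comp: "compose (carrier G) b a \<in> A" if "a \<in> A" "b \<in> A" for a b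
    using subgroup.m_closed[OF A that(2,1)] Bij that by (simp add: AutoGroup_def BijGroup_def)
  show "\<exists>c\<in>A. c ` H = b ` a ` H" if "a \<in> A" "b \<in> A" "H \<subseteq> carrier G" for a b H
    by (rule bexI[OF _ comp[OF that(1,2)]])
      (use that(3) in \<open>force simp: compose_def image_iff subset_iff\<close>)
  show "\<exists>c\<in>A. c ` a ` H = H" if a: "a \<in> A" and H: "H \<subseteq> carrier G" for a H
  proof -
    interpret AG: group "AutoGroup G" by (rule AutoGroup)
    let ?c = "inv\<^bsub>AutoGroup G\<^esub> a"
    have c: "?c \<in> A" by (rule subgroup.m_inv_closed[OF A a])
    have "?c \<otimes>\<^bsub>AutoGroup G\<^esub> a = \<one>\<^bsub>AutoGroup G\<^esub>"
      using AG.l_inv subgroup.subset[OF A] a by blast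
    then have *: "compose (carrier G) ?c a = (\<lambda>x\<in>carrier G. x)"
      using Bij a c by (simp add: AutoGroup_def BijGroup_def)
    have "?c (a x) = x" if "x \<in> carrier G" for x
      using fun_cong[OF *, of x] that by (simp add: compose_def)
    then have "?c ` a ` H = H" using H by (force simp: image_iff subset_iff)
    then show ?thesis using c by (rule bexI[where x = ?c])
  qed
qed

lemma aut_class_self:
  assumes "subgroup A (AutoGroup G)" "H \<subseteq> carrier G"
  shows "H \<in> aut_class A H"
  using aut_subgroup_facts(2)[OF assms] unfolding aut_class_def by auto

lemma aut_class_eq:
  assumes A: "subgroup A (AutoGroup G)" and H: "H \<subseteq> carrier G" and a: "a \<in> A"
  shows "aut_class A (a ` H) = aut_class A H"
proof (intro equalityI subsetI)
  fix S assume "S \<in> aut_class A (a ` H)"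
  then obtain b where b: "b \<in> A" "S = b ` a ` H" by (auto simp: aut_class_def)
  obtain c where "c \<in> A" "c ` H = b ` a ` H" using aut_subgroup_facts(3)[OF A a b(1) H] ..
  then have "S = c ` H \<and> c \<in> A" using b(2) by simp
  then show "S \<in> aut_class A H" unfolding aut_class_def mem_Collect_eq by (rule exI[where x = c])
next
  have aH: "a ` H \<subseteq> carrier G"
    using aut_subgroup_facts(1)[OF A a] H by (auto simp: auto_def hom_def Pi_iff)
  fix S assume "S \<in> aut_class A H"
  then obtain b where b: "b \<in> A" "S = b ` H" by (auto simp: aut_class_def)
  obtain c where c: "c \<in> A" "c ` a ` H = H" using aut_subgroup_facts(4)[OF A a H] ..
  obtain d where d: "d \<in> A" "d ` (a ` H) = b ` c ` (a ` H)"
    using aut_subgroup_facts(3)[OF A c(1) b(1) aH] ..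
  then have "S = d ` (a ` H)" using b c by simp
  then show "S \<in> aut_class A (a ` H)" using d(1) by (auto simp: aut_class_def)
qed

lemma class_poset_le_iff:
  assumes A: "subgroup A (AutoGroup G)" and "subgroup H G" "subgroup K G"
  shows "aut_class A H \<sqsubseteq>\<^bsub>class_poset A G\<^esub> aut_class A K \<longleftrightarrow> (\<exists>a\<in>A. a ` H \<subseteq> K)"
proof
  assume "aut_class A H \<sqsubseteq>\<^bsub>class_poset A G\<^esub> aut_class A K"
  then obtain H' K' a where *: "subgroup H' G" "subgroup K' G" "aut_class A H = aut_class A H'"
    "aut_class A K = aut_class A K'" "a \<in> A" "a ` H' \<subseteq> K'"
    by (auto simp: class_poset_def)
  have sub: "H \<subseteq> carrier G" "H' \<subseteq> carrier G" "K \<subseteq> carrier G" "K' \<subseteq> carrier G"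
    using assms(2,3) *(1,2) by (auto dest: subgroup.subset)
  obtain b where b: "b \<in> A" "H' = b ` H"
    using aut_class_self[OF A sub(2)] unfolding *(3)[symmetric] by (auto simp: aut_class_def)
  obtain c where c: "c \<in> A" "K = c ` K'"
    using aut_class_self[OF A sub(3)] unfolding *(4) by (auto simp: aut_class_def)
  obtain d where d: "d \<in> A" "d ` H = a ` b ` H"
    using aut_subgroup_facts(3)[OF A b(1) *(5) sub(1)] ..
  obtain e where e: "e \<in> A" "e ` H = c ` d ` H"
    using aut_subgroup_facts(3)[OF A d(1) c(1) sub(1)] ..
  have "e ` H \<subseteq> K" using *(6) unfolding e(2) d(2) c(2) b(2) by (rule image_mono)
  then show "\<exists>a\<in>A. a ` H \<subseteq> K" using e(1) by (rule bexI[where x = e])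
qed (use assms in \<open>auto simp: class_poset_def\<close>)

lemma partial_order_class_poset:
  assumes A: "subgroup A (AutoGroup G)" and fin: "finite (carrier G)"
  shows "partial_order (class_poset A G)"
proof -
  have eq [simp]: "(.=\<^bsub>class_poset A G\<^esub>) = (=)" by (simp add: class_poset_def)
  have carrier: "\<exists>H. subgroup H G \<and> S = aut_class A H" if "S \<in> carrier (class_poset A G)" for S
    using that by (auto simp: class_poset_def)
  note le = class_poset_le_iff[OF A]
  show ?thesis
  proof (unfold_locales, simp_all)
    fix S assume "S \<in> carrier (class_poset A G)"
    then obtain H where H: "subgroup H G" "S = aut_class A H" using carrier by blast
    obtain e where e: "e \<in> A" "e ` H = H"
      using aut_subgroup_facts(2)[OF A subgroup.subset[OF H(1)]] ..
    then have "\<exists>a\<in>A. a ` H \<subseteq> H" using e(1) by (intro bexI[of _ e]) simp_all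
    then show "S \<sqsubseteq>\<^bsub>class_poset A G\<^esub> S" unfolding H(2) le[OF H(1,1)] .
  next
    fix S T assume ST: "S \<sqsubseteq>\<^bsub>class_poset A G\<^esub> T" "T \<sqsubseteq>\<^bsub>class_poset A G\<^esub> S"
      "S \<in> carrier (class_poset A G)" "T \<in> carrier (class_poset A G)"
    obtain H K where HK: "subgroup H G" "S = aut_class A H" "subgroup K G" "T = aut_class A K"
      using carrier ST(3,4) by metis
    obtain a b where ab: "a \<in> A" "a ` H \<subseteq> K" "b \<in> A" "b ` K \<subseteq> H"
      using ST(1,2) unfolding HK(2,4) le[OF HK(1,3)] le[OF HK(3,1)] by blast
    have sub: "H \<subseteq> carrier G" "K \<subseteq> carrier G" using HK by (auto dest: subgroup.subset)
    have card: "card (c ` L) = card L" if "c \<in> A" "L \<subseteq> carrier G" for c L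
      using aut_subgroup_facts(1)[OF A that(1)] that(2)
      by (auto simp: auto_def Bij_def bij_betw_def intro!: card_image intro: inj_on_subset)
    have finHK: "finite H" "finite K" using fin sub finite_subset by blast+
    have "card K \<le> card H" using card_mono[OF finHK(1) ab(4)] card[OF ab(3) sub(2)] by simp
    then have "a ` H = K"
      using card_seteq[OF finHK(2) ab(2)] card[OF ab(1) sub(1)] by simp
    then show "S = T" using aut_class_eq[OF A sub(1) ab(1)] HK by simp
  next
    fix S T U assume *: "S \<sqsubseteq>\<^bsub>class_poset A G\<^esub> T" "T \<sqsubseteq>\<^bsub>class_poset A G\<^esub> U"
      "S \<in> carrier (class_poset A G)" "T \<in> carrier (class_poset A G)"
      "U \<in> carrier (class_poset A G)"
    obtain H K L where HKL: "subgroup H G" "S = aut_class A H" "subgroup K G" "T = aut_class A K"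
        "subgroup L G" "U = aut_class A L"
      using carrier *(3-5) by metis
    obtain a b where ab: "a \<in> A" "a ` H \<subseteq> K" "b \<in> A" "b ` K \<subseteq> L"
      using *(1,2) unfolding HKL(2,4,6) le[OF HKL(1,3)] le[OF HKL(3,5)] by blast
    obtain c where c: "c \<in> A" "c ` H = b ` a ` H"
      using aut_subgroup_facts(3)[OF A ab(1,3) subgroup.subset[OF HKL(1)]] ..
    note c(2)
    also have "\<dots> \<subseteq> L" using image_mono[OF ab(2), of b] ab(4) by (rule subset_trans)
    finally have "\<exists>c\<in>A. c ` H \<subseteq> L" using c(1) by (intro bexI[of _ c])
    then show "S \<sqsubseteq>\<^bsub>class_poset A G\<^esub> U" unfolding HKL(2,6) le[OF HKL(1,5)] .
  qed
qed

lemma finite_class_poset: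
  assumes "finite (carrier G)"
  shows "finite (carrier (class_poset A G))"
proof -
  have "carrier (class_poset A G) \<subseteq> aut_class A ` Pow (carrier G)"
    by (auto simp: class_poset_def intro!: imageI dest: subgroup.subset)
  then show ?thesis by (rule finite_subset) (use assms in simp)
qed

lemma conj_aut_auto:
  assumes g: "g \<in> carrier G"
  shows "conj_aut G g \<in> auto G"
proof -
  have cancel: "g \<otimes> (inv g \<otimes> x) = x" "inv g \<otimes> (g \<otimes> x) = x" if "x \<in> carrier G" for x
    using g that by (simp_all add: m_assoc[symmetric])
  have "bij_betw (conj_aut G g) (carrier G) (carrier G)"
    by (rule bij_betw_byWitness[where f' = "\<lambda>x. g \<otimes> x \<otimes> inv g"])
      (use g in \<open>auto simp: conj_aut_def m_assoc cancel\<close>)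
  moreover have "conj_aut G g \<in> hom G G"
  proof (rule homI)
    fix x y assume xy: "x \<in> carrier G" "y \<in> carrier G"
    show "conj_aut G g (x \<otimes> y) = conj_aut G g x \<otimes> conj_aut G g y"
      using g xy by (simp add: conj_aut_def m_assoc cancel)
  qed (use g in \<open>auto simp: conj_aut_def\<close>)
  ultimately show ?thesis by (auto simp: auto_def Bij_def conj_aut_def)
qed

lemma subgroup_conj_aut:
  assumes K: "subgroup K G"
  shows "subgroup (conj_aut G ` K) (AutoGroup G)"
proof -
  interpret AG: group "AutoGroup G" by (rule AutoGroup)
  have sub: "K \<subseteq> carrier G" by (rule subgroup.subset[OF K])
  have aut: "conj_aut G g \<in> carrier (AutoGroup G)" if "g \<in> carrier G" for g
    using conj_aut_auto[OF that] by (simp add: AutoGroup_def)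
  have one: "conj_aut G \<one> = \<one>\<^bsub>AutoGroup G\<^esub>"
    by (auto simp: conj_aut_def AutoGroup_def BijGroup_def fun_eq_iff restrict_def)
  have mult: "conj_aut G g \<otimes>\<^bsub>AutoGroup G\<^esub> conj_aut G h = conj_aut G (h \<otimes> g)"
    if "g \<in> carrier G" "h \<in> carrier G" for g h
  proof -
    have "conj_aut G g \<otimes>\<^bsub>AutoGroup G\<^esub> conj_aut G h =
        compose (carrier G) (conj_aut G g) (conj_aut G h)"
      using conj_aut_auto that by (auto simp: AutoGroup_def BijGroup_def auto_def)
    also have "\<dots> = conj_aut G (h \<otimes> g)"
      using that by (auto simp: conj_aut_def compose_def fun_eq_iff m_assoc inv_mult_group)
    finally show ?thesis .
  qed
  show ?thesis
  proof (rule AG.subgroupI)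
    show "conj_aut G ` K \<subseteq> carrier (AutoGroup G)" using aut sub by blast
    show "conj_aut G ` K \<noteq> {}" using subgroup.one_closed[OF K] by blast
  next
    fix a assume "a \<in> conj_aut G ` K"
    then obtain g where g: "g \<in> K" "a = conj_aut G g" by blast
    then have gG: "g \<in> carrier G" using sub by blast
    have "conj_aut G (inv g) \<otimes>\<^bsub>AutoGroup G\<^esub> a = \<one>\<^bsub>AutoGroup G\<^esub>"
      using mult[of "inv g" g] gG g one by simp
    then have "inv\<^bsub>AutoGroup G\<^esub> a = conj_aut G (inv g)"
      using AG.inv_equality aut gG g by simp
    then show "inv\<^bsub>AutoGroup G\<^esub> a \<in> conj_aut G ` K"
      using subgroup.m_inv_closed[OF K g(1)] by simp
  next
    fix a b assume "a \<in> conj_aut G ` K" "b \<in> conj_aut G ` K"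
    then obtain g h where "g \<in> K" "a = conj_aut G g" "h \<in> K" "b = conj_aut G h" by blast
    then show "a \<otimes>\<^bsub>AutoGroup G\<^esub> b \<in> conj_aut G ` K"
      using mult[of g h] sub subgroup.m_closed[OF K] by auto
  qed
qed

end

end

theory Submission
  imports Defs
begin

text \<open>
  Induction on the order of \<open>G\<close>. For \<open>H \<noteq> G\<close> let \<open>D\<close> be the last term of the derived series
  not contained in \<open>H\<close>, and \<open>N \<subseteq> D\<close> minimal among the normal subgroups of \<open>G\<close> not contained
  in \<open>H\<close>. Crapo's theorem for the closure \<open>T \<mapsto> TN\<close> expresses the Moebius value at
  \<open>(H, G)\<close> as minus the sum of those at \<open>(H, M)\<close>, over the classes of proper supplements
  \<open>M\<close> of \<open>N\<close> above \<open>H\<close>. As \<open>N' \<subseteq> H\<close>, the group \<open>N \<inter> M\<close> is normal in \<open>G\<close>, hence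
  contained in \<open>H\<close> by minimality. If \<open>T\<close> and \<open>T\<^sup>n\<close> both lie between \<open>N \<inter> M\<close> and \<open>M\<close>, for some
  \<open>n \<in> N\<close>, then \<open>[T, n] \<subseteq> N \<inter> M \<subseteq> T\<close>, so \<open>T\<^sup>n = T\<close>. Hence the interval from
  \<open>H\<close> to \<open>M\<close> is an interval in the poset of \<open>M\<close> under the group \<open>KN \<inter> M\<close>, to which the induction
  hypothesis applies. The classes of the supplements are the same under \<open>K\<close> and under \<open>G\<close>:
  either \<open>N \<subseteq> G' \<subseteq> K\<close>, or \<open>N \<inter> G' \<subseteq> H\<close> and \<open>N\<close> normalises every such \<open>M\<close>.
\<close>

text \<open>\<open>f\<close> and \<open>g\<close> have the same fibres on \<open>S\<close>, so
  \<open>f s\<close> corresponds to \<open>g s\<close> bijectively even when neither map is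
  injective. This fits sums over classes of subgroups, where one class has many
  representatives.\<close>

lemma sum_image_eq:
  assumes eq: "\<And>s t. s \<in> S \<Longrightarrow> t \<in> S \<Longrightarrow> f s = f t \<longleftrightarrow> g s = g t"
    and FG: "\<And>s. s \<in> S \<Longrightarrow> F (f s) = G (g s)"
  shows "sum F (f ` S) = sum G (g ` S)"
proof -
  have f: "inv_into S f (f s) \<in> S" "f (inv_into S f (f s)) = f s" if "s \<in> S" for s
    using that by (auto intro: inv_into_into f_inv_into_f)
  have g: "inv_into S g (g s) \<in> S" "g (inv_into S g (g s)) = g s" if "s \<in> S" for s
    using that by (auto intro: inv_into_into f_inv_into_f)
  have gf: "g (inv_into S f (f s)) = g s" if "s \<in> S" for s
    using eq[OF f(1)[OF that] that] f(2)[OF that] by simp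
  have fg: "f (inv_into S g (g s)) = f s" if "s \<in> S" for s
    using eq[OF g(1)[OF that] that] g(2)[OF that] by simp
  show ?thesis
    by (rule sum.reindex_bij_witness[where i = "\<lambda>z. f (inv_into S g z)"
          and j = "\<lambda>z. g (inv_into S f z)"]) (auto simp: fg gf FG)
qed

section \<open>Moebius functions\<close>

lemma moebius_refl:
  assumes "partial_order P" "finite (carrier P)" "x \<in> carrier P"
  shows "moebius P x x = 1"
  using is_moebius_moebius[OF assms(1,2)] assms(3) by (simp add: is_moebius_def)

lemma sum_moebius_interval:
  assumes "partial_order P" "finite (carrier P)" "x \<in> carrier P" "y \<in> carrier P" "x \<sqsubset>\<^bsub>P\<^esub> y"
  shows "(\<Sum>z | z \<in> carrier P \<and> x \<sqsubseteq>\<^bsub>P\<^esub> z \<and> z \<sqsubseteq>\<^bsub>P\<^esub> y. moebius P x z) = 0"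
  using is_moebius_moebius[OF assms(1,2)] assms(3-5) by (simp add: is_moebius_def)

lemma moebius_eq_sum:
  assumes "partial_order P" "finite (carrier P)" "x \<in> carrier P" "y \<in> carrier P" "x \<sqsubset>\<^bsub>P\<^esub> y"
  shows "moebius P x y =
    - (\<Sum>z | z \<in> carrier P \<and> x \<sqsubseteq>\<^bsub>P\<^esub> z \<and> z \<sqsubset>\<^bsub>P\<^esub> y. moebius P x z)"
  using sum_moebius_interval[OF assms] interval_split[OF assms, of "moebius P x"] by simp

text \<open>The intervals are compared through a common, possibly redundant, set \<open>S\<close> of representatives.\<close>

lemma moebius_interval_cong:
  assumes P: "partial_order P" "finite (carrier P)"
    and Q: "partial_order Q" "finite (carrier Q)"
    and S: "f ` S \<subseteq> carrier P" "g ` S \<subseteq> carrier Q"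
    and le: "\<And>s t. s \<in> S \<Longrightarrow> t \<in> S \<Longrightarrow> f s \<sqsubseteq>\<^bsub>P\<^esub> f t \<longleftrightarrow> g s \<sqsubseteq>\<^bsub>Q\<^esub> g t"
    and xy: "x \<in> S" "y \<in> S"
    and f: "\<And>z. z \<in> carrier P \<Longrightarrow> f x \<sqsubseteq>\<^bsub>P\<^esub> z \<Longrightarrow> z \<sqsubseteq>\<^bsub>P\<^esub> f y \<Longrightarrow> z \<in> f ` S"
    and g: "\<And>z. z \<in> carrier Q \<Longrightarrow> g x \<sqsubseteq>\<^bsub>Q\<^esub> z \<Longrightarrow> z \<sqsubseteq>\<^bsub>Q\<^esub> g y \<Longrightarrow> z \<in> g ` S"
  shows "moebius P (f x) (f y) = moebius Q (g x) (g y)"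
proof -
  interpret P: partial_order P by fact
  interpret Q: partial_order Q by fact
  have fS: "f s \<in> carrier P" and gS: "g s \<in> carrier Q" if "s \<in> S" for s
    using S that by auto
  have eq: "f s = f t \<longleftrightarrow> g s = g t" if "s \<in> S" "t \<in> S" for s t
    using le[OF that] le[OF that(2,1)] P.le_antisym Q.le_antisym P.le_refl Q.le_refl fS gS that
    by metis
  have less: "f s \<sqsubset>\<^bsub>P\<^esub> f t \<longleftrightarrow> g s \<sqsubset>\<^bsub>Q\<^esub> g t" if "s \<in> S" "t \<in> S" for s t
    using le[OF that] eq[OF that] by (simp add: lless_def P.eq_is_equal Q.eq_is_equal)
  \<comment> \<open>The well-founded relation lives on \<open>P\<close>, so the induction runs over
    the element \<open>v\<close>, and its representative \<open>t\<close> varies with it.\<close>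
  have "moebius P (f x) v = moebius Q (g x) (g t)" if "v = f t" "t \<in> S" "f t \<sqsubseteq>\<^bsub>P\<^esub> f y" for v t
    using that
  proof (induction v arbitrary: t rule: wf_induct_rule[OF wf_strict_order[OF P]])
    case (1 v)
    note t = \<open>v = f t\<close> \<open>t \<in> S\<close> \<open>f t \<sqsubseteq>\<^bsub>P\<^esub> f y\<close>
    have gty: "g t \<sqsubseteq>\<^bsub>Q\<^esub> g y" using t le xy by simp
    consider "f x = f t" | "f x \<sqsubset>\<^bsub>P\<^esub> f t" | "\<not> f x \<sqsubseteq>\<^bsub>P\<^esub> f t"
      by (auto simp: lless_def P.eq_is_equal)
    then show ?case
    proof cases
      case 1
      then show ?thesis using eq[OF xy(1) t(2)] t moebius_refl[OF P] moebius_refl[OF Q] fS gS by simp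
    next
      case 2
      \<comment> \<open>Both half-open intervals in the recursion for the Moebius values are images
        of this one index set.\<close>
      let ?I = "{s \<in> S. f x \<sqsubseteq>\<^bsub>P\<^esub> f s \<and> f s \<sqsubset>\<^bsub>P\<^esub> f t}"
      have IP: "{z. z \<in> carrier P \<and> f x \<sqsubseteq>\<^bsub>P\<^esub> z \<and> z \<sqsubset>\<^bsub>P\<^esub> f t} = f ` ?I"
      proof (intro equalityI subsetI)
        fix z assume z: "z \<in> {z. z \<in> carrier P \<and> f x \<sqsubseteq>\<^bsub>P\<^esub> z \<and> z \<sqsubset>\<^bsub>P\<^esub> f t}"
        then have "z \<sqsubseteq>\<^bsub>P\<^esub> f y"
          using P.le_trans[of z "f t" "f y"] t fS xy by (auto simp: lless_def)
        then show "z \<in> f ` ?I" using f z by blast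
      qed (use fS in auto)
      have IQ: "{z. z \<in> carrier Q \<and> g x \<sqsubseteq>\<^bsub>Q\<^esub> z \<and> z \<sqsubset>\<^bsub>Q\<^esub> g t} = g ` ?I"
      proof (intro equalityI subsetI)
        fix z assume z: "z \<in> {z. z \<in> carrier Q \<and> g x \<sqsubseteq>\<^bsub>Q\<^esub> z \<and> z \<sqsubset>\<^bsub>Q\<^esub> g t}"
        then have "z \<sqsubseteq>\<^bsub>Q\<^esub> g y"
          using Q.le_trans[of z "g t" "g y"] gty t gS xy by (auto simp: lless_def)
        then obtain s where "s \<in> S" "z = g s" using g z by blast
        then show "z \<in> g ` ?I" using z le less xy t by auto
      qed (use gS le less xy t in auto)
      have IH: "moebius P (f x) (f s) = moebius Q (g x) (g s)" if "s \<in> ?I" for s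
      proof (rule 1(1)[OF _ refl])
        show "(f s, v) \<in> {(z, y). z \<in> carrier P \<and> y \<in> carrier P \<and> z \<sqsubset>\<^bsub>P\<^esub> y}"
          using that t fS by auto
        show "s \<in> S" using that by simp
        then show "f s \<sqsubseteq>\<^bsub>P\<^esub> f y"
          using P.le_trans[of "f s" "f t" "f y"] that t fS xy by (auto simp: lless_def)
      qed
      have "(\<Sum>z\<in>f ` ?I. moebius P (f x) z) = (\<Sum>z\<in>g ` ?I. moebius Q (g x) z)"
        by (rule sum_image_eq) (use eq IH in auto)
      then show ?thesis
        using moebius_eq_sum[OF P fS fS 2] moebius_eq_sum[OF Q gS gS] less[of x t] 2 xy t
        by (simp add: IP IQ)
    next
      case 3
      then have "\<not> g x \<sqsubseteq>\<^bsub>Q\<^esub> g t" using le xy t by simp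
      then show ?thesis
        using 3 t xy fS gS is_moebius_moebius[OF P] is_moebius_moebius[OF Q]
        by (simp add: is_moebius_def)
    qed
  qed
  then show ?thesis using xy fS by simp
qed

text \<open>Crapo's closure theorem.\<close>

lemma sum_moebius_closure:
  assumes P: "partial_order P" "finite (carrier P)"
    and closed: "\<And>z. z \<in> carrier P \<Longrightarrow> c z \<in> carrier P"
    and mono: "\<And>z w. z \<in> carrier P \<Longrightarrow> w \<in> carrier P \<Longrightarrow> z \<sqsubseteq>\<^bsub>P\<^esub> w \<Longrightarrow> c z \<sqsubseteq>\<^bsub>P\<^esub> c w"
    and ext: "\<And>z. z \<in> carrier P \<Longrightarrow> z \<sqsubseteq>\<^bsub>P\<^esub> c z"
    and idem: "\<And>z. z \<in> carrier P \<Longrightarrow> c (c z) = c z"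
    and x: "x \<in> carrier P" "c x \<noteq> x"
    and y: "y \<in> carrier P" "c y = y"
  shows "(\<Sum>z | z \<in> carrier P \<and> x \<sqsubseteq>\<^bsub>P\<^esub> z \<and> c z = y. moebius P x z) = 0"
  using y
proof (induction y rule: wf_induct_rule[OF wf_strict_order[OF P]])
  case (1 y)
  interpret partial_order P by fact
  define Z where "Z w = {z. z \<in> carrier P \<and> x \<sqsubseteq>\<^bsub>P\<^esub> z \<and> c z = w}" for w
  show ?case
  proof (cases "x \<sqsubseteq>\<^bsub>P\<^esub> y")
    case True
    \<comment> \<open>The fibres of \<open>c\<close> over the closed elements below \<open>y\<close>
      partition the interval from \<open>x\<close> to \<open>y\<close>, whose total is 0. By
      induction the fibres over \<open>w \<noteq> y\<close> contribute 0, so the fibre over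
      \<open>y\<close> does as well.\<close>
    define W where "W = {w \<in> carrier P. c w = w \<and> w \<sqsubseteq>\<^bsub>P\<^esub> y}"
    \<comment> \<open>Strict, because \<open>y\<close> is closed and \<open>x\<close> is
      not.\<close>
    have "x \<sqsubset>\<^bsub>P\<^esub> y" using True x 1(3) by (auto simp: lless_def eq_is_equal)
    then have "0 = (\<Sum>z | z \<in> carrier P \<and> x \<sqsubseteq>\<^bsub>P\<^esub> z \<and> z \<sqsubseteq>\<^bsub>P\<^esub> y. moebius P x z)"
      using sum_moebius_interval[OF P x(1) 1(2)] by simp
    also have "{z. z \<in> carrier P \<and> x \<sqsubseteq>\<^bsub>P\<^esub> z \<and> z \<sqsubseteq>\<^bsub>P\<^esub> y} = \<Union> (Z ` W)"
    proof (intro equalityI subsetI)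
      fix z assume z: "z \<in> {z. z \<in> carrier P \<and> x \<sqsubseteq>\<^bsub>P\<^esub> z \<and> z \<sqsubseteq>\<^bsub>P\<^esub> y}"
      then have "c z \<in> W" using mono[of z y] closed idem 1(2,3) by (simp add: W_def)
      then show "z \<in> \<Union> (Z ` W)" using z by (auto simp: Z_def)
    next
      fix z assume "z \<in> \<Union> (Z ` W)"
      then have z: "z \<in> carrier P" "x \<sqsubseteq>\<^bsub>P\<^esub> z" "c z \<sqsubseteq>\<^bsub>P\<^esub> y" by (auto simp: Z_def W_def)
      then show "z \<in> {z. z \<in> carrier P \<and> x \<sqsubseteq>\<^bsub>P\<^esub> z \<and> z \<sqsubseteq>\<^bsub>P\<^esub> y}"
        using le_trans[OF ext[OF z(1)] z(3)] closed 1(2) by simp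
    qed
    also have "(\<Sum>z\<in>\<Union> (Z ` W). moebius P x z) = (\<Sum>w\<in>W. \<Sum>z\<in>Z w. moebius P x z)"
      by (rule sum.UNION_disjoint) (use P(2) in \<open>auto simp: W_def Z_def\<close>)
    also have "\<dots> = (\<Sum>w\<in>W. if w = y then \<Sum>z\<in>Z y. moebius P x z else 0)"
    proof (rule sum.cong[OF HOL.refl])
      fix w assume w: "w \<in> W"
      show "(\<Sum>z\<in>Z w. moebius P x z) = (if w = y then \<Sum>z\<in>Z y. moebius P x z else 0)"
      proof (cases "w = y")
        case False
        then show ?thesis
          using 1(1)[of w] w 1(2) by (auto simp: W_def Z_def lless_def eq_is_equal)
      qed simp
    qed
    also have "\<dots> = (\<Sum>z\<in>Z y. moebius P x z)"
      using P(2) 1(2,3) by (subst sum.delta) (auto simp: W_def)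
    finally show ?thesis by (simp add: Z_def)
  next
    case False
    have "z \<in> Z y \<Longrightarrow> x \<sqsubseteq>\<^bsub>P\<^esub> y" for z
      using le_trans[OF _ ext, of x z] x(1) closed by (auto simp: Z_def)
    then have "Z y = {}" using False by blast
    then have "{z. z \<in> carrier P \<and> x \<sqsubseteq>\<^bsub>P\<^esub> z \<and> c z = y} = {}" by (simp add: Z_def)
    then show ?thesis by (simp only: sum.empty)
  qed
qed


section \<open>Conjugation\<close>

context group
begin

lemma conj_aut_apply:
  "x \<in> carrier G \<Longrightarrow> conj_aut G g x = inv g \<otimes> x \<otimes> g"
  by (simp add: conj_aut_def)

lemma conj_aut_hom: "g \<in> carrier G \<Longrightarrow> group_hom G G (conj_aut G g)"
  using conj_aut_auto[of g] by unfold_locales (simp add: auto_def)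

lemma subgroup_conj_aut_image:
  "g \<in> carrier G \<Longrightarrow> subgroup T G \<Longrightarrow> subgroup (conj_aut G g ` T) G"
  by (rule group_hom.subgroup_img_is_subgroup[OF conj_aut_hom])

lemma inj_on_conj_aut: "g \<in> carrier G \<Longrightarrow> T \<subseteq> carrier G \<Longrightarrow> inj_on (conj_aut G g) T"
  using conj_aut_auto[of g] by (auto simp: auto_def Bij_def bij_betw_def intro: inj_on_subset)

text \<open>Conjugation is a right action: in \<open>g \<otimes> h\<close> the factor
  \<open>g\<close> acts first.\<close>

lemma conj_aut_image_mult:
  assumes "T \<subseteq> carrier G" "g \<in> carrier G" "h \<in> carrier G"
  shows "conj_aut G (g \<otimes> h) ` T = conj_aut G h ` conj_aut G g ` T"
  unfolding image_image
  by (rule image_cong) (use assms in \<open>auto simp: conj_aut_apply subset_iff m_assoc inv_mult_group\<close>)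

lemma normal_conj_aut_image:
  assumes N: "N \<lhd> G" and fin: "finite (carrier G)" and g: "g \<in> carrier G"
  shows "conj_aut G g ` N = N"
proof (rule card_subset_eq)
  interpret normal N G by fact
  show "finite N" using fin subset finite_subset by blast
  show "conj_aut G g ` N \<subseteq> N" using inv_op_closed1 g by (auto simp: conj_aut_apply)
  show "card (conj_aut G g ` N) = card N" using inj_on_conj_aut[OF g subset] by (rule card_image)
qed

text \<open>The last hypothesis says that the commutator \<open>[t, g]\<close> lies in
  \<open>T\<close>. Then \<open>t[t, g]\<close>, the conjugate of \<open>t\<close> by
  \<open>g\<close>, lies in \<open>T\<close> too, and equal finite cardinality turns the inclusion
  into equality.\<close>

lemma conj_aut_image_self:
  assumes T: "subgroup T G" and fin: "finite (carrier G)" and g: "g \<in> carrier G"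
    and comm: "\<And>t. t \<in> T \<Longrightarrow> inv t \<otimes> (inv g \<otimes> t \<otimes> g) \<in> T"
  shows "conj_aut G g ` T = T"
proof (rule card_subset_eq)
  interpret T: subgroup T G by fact
  show "finite T" using fin T.subset finite_subset by blast
  show "conj_aut G g ` T \<subseteq> T"
  proof clarify
    fix t assume t: "t \<in> T"
    have "t \<otimes> (inv t \<otimes> (inv g \<otimes> t \<otimes> g)) \<in> T" using T.m_closed[OF t comm[OF t]] .
    moreover have "t \<otimes> (inv t \<otimes> (inv g \<otimes> t \<otimes> g)) = inv g \<otimes> t \<otimes> g"
      using t g T.subset by (simp add: m_assoc[symmetric] subset_iff)
    ultimately show "conj_aut G g t \<in> T" using t T.subset by (auto simp: conj_aut_apply)
  qed
  show "card (conj_aut G g ` T) = card T"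
    using inj_on_conj_aut[OF g T.subset] by (rule card_image)
qed

lemma normal_commutator:
  assumes N: "N \<lhd> G" and "n \<in> N" "g \<in> carrier G"
  shows "inv g \<otimes> (inv n \<otimes> g \<otimes> n) \<in> N"
proof -
  interpret normal N G by fact
  have "(inv g \<otimes> inv n \<otimes> g) \<otimes> n \<in> N" using assms inv_op_closed1 by blast
  then show ?thesis using assms subset by (auto simp: m_assoc)
qed

text \<open>Each map is restricted to the carrier of its own group, so the comparison is made on
  images of subsets of \<open>M\<close>.\<close>

lemma conj_aut_restrict_image:
  assumes M: "subgroup M G" and "m \<in> M" "T \<subseteq> M"
  shows "conj_aut (G\<lparr>carrier := M\<rparr>) m ` T = conj_aut G m ` T"
  by (rule image_cong)
    (use assms subgroup.subset[OF M] in \<open>auto simp: conj_aut_def m_inv_consistent subset_iff\<close>)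

lemma set_mult_normal_subgroup:
  assumes T: "subgroup T G" and N: "N \<lhd> G"
  shows "subgroup (T <#> N) G"
  using commut_normal[OF assms] mult_norm_subgroup[OF N T] by simp

lemma subset_set_mult:
  assumes "subgroup T G" "subgroup N G"
  shows "T \<subseteq> T <#> N" "N \<subseteq> T <#> N"
proof -
  show "T \<subseteq> T <#> N"
  proof
    fix t assume "t \<in> T"
    then show "t \<in> T <#> N"
      using subgroup.one_closed[OF assms(2)] subgroup.mem_carrier[OF assms(1)]
      unfolding set_mult_def by (force intro: r_one[symmetric])
  qed
  show "N \<subseteq> T <#> N"
  proof
    fix n assume "n \<in> N"
    then show "n \<in> T <#> N"
      using subgroup.one_closed[OF assms(1)] subgroup.mem_carrier[OF assms(2)]
      unfolding set_mult_def by (force intro: l_one[symmetric])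
  qed
qed

lemma aut_class_eq_iff:
  assumes A: "subgroup A (AutoGroup G)" and "H \<subseteq> carrier G" "T \<subseteq> carrier G"
  shows "aut_class A H = aut_class A T \<longleftrightarrow> (\<exists>a\<in>A. a ` H = T)"
proof
  assume "aut_class A H = aut_class A T"
  then have "T \<in> aut_class A H" using aut_class_self[OF A assms(3)] by simp
  then show "\<exists>a\<in>A. a ` H = T" by (auto simp: aut_class_def)
next
  assume "\<exists>a\<in>A. a ` H = T"
  then show "aut_class A H = aut_class A T" using aut_class_eq[OF A assms(2)] by metis
qed

section \<open>Crapo's theorem for the closure by a normal subgroup\<close>

text \<open>Multiplication by \<open>N\<close> is a closure operator on the classes. The class of
  \<open>H\<close> is not closed, as \<open>H <#> N\<close> properly contains \<open>H\<close> and
  so is larger than every conjugate of \<open>H\<close>. The fibre over the class of the whole group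
  consists of that class and of the classes of proper supplements above \<open>H\<close>; isolating
  the first term gives the formula.\<close>

lemma sum_mu_supplements:
  assumes fin: "finite (carrier G)" and K: "subgroup K G" and N: "N \<lhd> G"
    and H: "subgroup H G" and NH: "\<not> N \<subseteq> H"
    and A: "A = conj_aut G ` K"
  shows "mu A G H (carrier G) =
    - (\<Sum>z \<in> aut_class A ` {M. subgroup M G \<and> H \<subseteq> M \<and> M \<noteq> carrier G \<and> M <#> N = carrier G}.
        moebius (class_poset A G) (aut_class A H) z)"
proof -
  let ?P = "class_poset A G"
  define S where "S = {M. subgroup M G \<and> H \<subseteq> M \<and> M \<noteq> carrier G \<and> M <#> N = carrier G}"
  \<comment> \<open>Acting on every member of a class avoids choosing a representative; normality of
    \<open>N\<close> makes the result a class again.\<close>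
  define c where "c = (\<lambda>Z. (\<lambda>T. T <#> N) ` Z)"
  note Aut = subgroup_conj_aut[OF K, folded A]
  note P = partial_order_class_poset[OF Aut fin] finite_class_poset[OF fin, of A]
  note le = class_poset_le_iff[OF Aut]
  interpret P: partial_order ?P by (rule P)
  have N': "subgroup N G" using N by (rule normal_imp_subgroup)
  have K': "K \<subseteq> carrier G" using K by (rule subgroup.subset)
  have cl: "aut_class A T \<in> carrier ?P" if "subgroup T G" for T
    using that by (auto simp: class_poset_def)
  have rep: "\<exists>T. subgroup T G \<and> z = aut_class A T" if "z \<in> carrier ?P" for z
    using that by (auto simp: class_poset_def)
  have sub: "T \<subseteq> carrier G" if "subgroup T G" for T using that by (rule subgroup.subset)
  have img: "a ` (T <#> N) = a ` T <#> N" if "a \<in> A" "subgroup T G" for a T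
  proof -
    obtain k where k: "k \<in> carrier G" "a = conj_aut G k" using \<open>a \<in> A\<close> A K' by auto
    then show ?thesis
      using set_mult_hom[OF _ sub[OF that(2)] sub[OF N'], of a G] conj_aut_auto[OF k(1)]
        normal_conj_aut_image[OF N fin k(1)] by (simp add: auto_def)
  qed
  have c: "c (aut_class A T) = aut_class A (T <#> N)" if "subgroup T G" for T
  proof -
    have "c (aut_class A T) = {a ` T <#> N | a. a \<in> A}" by (auto simp: c_def aut_class_def)
    also have "\<dots> = aut_class A (T <#> N)" unfolding aut_class_def using img[OF _ that] by metis
    finally show ?thesis .
  qed
  have TN: "subgroup (T <#> N) G" if "subgroup T G" for T
    using set_mult_normal_subgroup[OF that N] .
  have TNN: "T <#> N <#> N = T <#> N" if "subgroup T G" for T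
    using set_mult_assoc[OF sub[OF that] sub[OF N'] sub[OF N']] subgroup_mult_id[OF N'] by simp
  have G: "subgroup (carrier G) G" by (rule subgroup_self)
  have autG: "a ` carrier G = carrier G" if "a \<in> A" for a
    using aut_subgroup_facts(1)[OF Aut that] by (simp add: auto_def Bij_def bij_betw_def)
  have eqG: "aut_class A T = aut_class A (carrier G) \<longleftrightarrow> T = carrier G" if "subgroup T G" for T
    using aut_class_eq_iff[OF Aut sub[OF G] sub[OF that]] autG
      aut_subgroup_facts(2)[OF Aut sub[OF G]] by metis
  have id: "\<exists>a\<in>A. a ` T = T" if "subgroup T G" for T
    using aut_subgroup_facts(2)[OF Aut sub[OF that]] .
  have ge: "aut_class A T \<sqsubseteq>\<^bsub>?P\<^esub> aut_class A U" if "subgroup T G" "subgroup U G" "T \<subseteq> U" for T U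
    using le[OF that(1,2)] id[OF that(1)] that(3) by metis
  have "(\<Sum>z | z \<in> carrier ?P \<and> aut_class A H \<sqsubseteq>\<^bsub>?P\<^esub> z \<and> c z = aut_class A (carrier G).
      moebius ?P (aut_class A H) z) = 0"
  proof (rule sum_moebius_closure[OF P])
    fix z assume "z \<in> carrier ?P"
    then obtain T where T: "subgroup T G" "z = aut_class A T" using rep by blast
    show "c z \<in> carrier ?P" using T c cl TN by simp
    show "z \<sqsubseteq>\<^bsub>?P\<^esub> c z" using T c ge[OF T(1) TN] subset_set_mult(1)[OF T(1) N'] by simp
    show "c (c z) = c z" using T c TN TNN by simp
  next
    fix z w assume "z \<in> carrier ?P" "w \<in> carrier ?P" and zw: "z \<sqsubseteq>\<^bsub>?P\<^esub> w"
    then obtain T U where T: "subgroup T G" "z = aut_class A T" and U: "subgroup U G" "w = aut_class A U"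
      using rep by metis
    obtain a where a: "a \<in> A" "a ` T \<subseteq> U" using zw le T U by auto
    have "a ` (T <#> N) \<subseteq> U <#> N" using img[OF a(1) T(1)] mono_set_mult[OF a(2) order.refl] by simp
    then show "c z \<sqsubseteq>\<^bsub>?P\<^esub> c w" using le[OF TN TN] T U c a(1) by auto
  next
    show "aut_class A H \<in> carrier ?P" "aut_class A (carrier G) \<in> carrier ?P" using cl H G by auto
    have "T <#> N = carrier G" if "T = carrier G" for T using set_mult_carrier_idem[OF N'] that by simp
    then show "c (aut_class A (carrier G)) = aut_class A (carrier G)" using c[OF G] by simp
    show "c (aut_class A H) \<noteq> aut_class A H"
    proof
      assume "c (aut_class A H) = aut_class A H"
      then obtain a where a: "a \<in> A" "a ` H = H <#> N"
        using c[OF H] aut_class_eq_iff[OF Aut sub[OF H] sub[OF TN[OF H]]] by auto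
      then have "card (H <#> N) = card H"
        using inj_on_conj_aut[of _ H] sub[OF H] K' A by (metis card_image imageE subset_iff)
      moreover have "finite (H <#> N)" using finite_subset[OF sub[OF TN[OF H]] fin] .
      ultimately have "H <#> N = H"
        using card_subset_eq[of "H <#> N" H] subset_set_mult(1)[OF H N'] by simp
      then show False using subset_set_mult(2)[OF H N'] NH by simp
    qed
  qed
  moreover have "{z. z \<in> carrier ?P \<and> aut_class A H \<sqsubseteq>\<^bsub>?P\<^esub> z \<and> c z = aut_class A (carrier G)} =
    insert (aut_class A (carrier G)) (aut_class A ` S)" (is "?L = ?R")
  proof (intro equalityI subsetI)
    fix z assume z: "z \<in> ?L"
    then obtain T where T: "subgroup T G" "z = aut_class A T" using rep by blast
    obtain a where a: "a \<in> A" "a ` H \<subseteq> T" using z le[OF H T(1)] T by auto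
    \<comment> \<open>The order on classes only puts a conjugate of \<open>H\<close> inside
      \<open>T\<close>. Conjugating back by \<open>b\<close> gives a representative that contains
      \<open>H\<close> itself.\<close>
    obtain b where b: "b \<in> A" "b ` a ` H = H" using aut_subgroup_facts(4)[OF Aut a(1) sub[OF H]] by blast
    have bT: "subgroup (b ` T) G" using b(1) A K' subgroup_conj_aut_image[OF _ T(1)] by auto
    have zb: "z = aut_class A (b ` T)" using aut_class_eq[OF Aut sub[OF T(1)] b(1)] T by simp
    have "b ` T <#> N = carrier G" using z zb c[OF bT] eqG[OF TN[OF bT]] by simp
    moreover have "H \<subseteq> b ` T" using image_mono[OF a(2), of b] b by simp
    ultimately show "z \<in> ?R" using zb bT by (auto simp: S_def)
  next
    fix z assume "z \<in> ?R"
    then obtain T where T: "subgroup T G" "z = aut_class A T" "H \<subseteq> T" "T <#> N = carrier G"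
      using G sub[OF H] set_mult_carrier_idem[OF N'] by (auto simp: S_def)
    then show "z \<in> ?L" using cl ge H c by simp
  qed
  moreover have "aut_class A (carrier G) \<notin> aut_class A ` S"
    using eqG by (auto simp: S_def)
  moreover have "finite (aut_class A ` S)"
    by (rule finite_subset[OF _ P(2)]) (use cl in \<open>auto simp: S_def\<close>)
  ultimately show ?thesis by (simp add: mu_def S_def)
qed

section \<open>Supplements of a normal subgroup\<close>

text \<open>For \<open>t\<close> in \<open>T\<close> the commutator \<open>[t, n]\<close> lies in
  \<open>N\<close> by normality. It lies in \<open>M\<close> either because \<open>t\<close> and its
  conjugate by \<open>n\<close> both do, or because every commutator with \<open>n\<close> does.
  Hence it lies in \<open>N \<inter> M\<close>, and so in \<open>T\<close>.\<close>

lemma conj_normal_part_self: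
  assumes fin: "finite (carrier G)" and N: "N \<lhd> G" and n: "n \<in> N"
    and T: "subgroup T G" "N \<inter> M \<subseteq> T" and M: "subgroup M G" "T \<subseteq> M"
    and n': "conj_aut G n ` T \<subseteq> M \<or> (\<forall>g\<in>carrier G. inv g \<otimes> (inv n \<otimes> g \<otimes> n) \<in> M)"
  shows "conj_aut G n ` T = T"
proof (rule conj_aut_image_self[OF T(1) fin])
  interpret N: normal N G by fact
  show "n \<in> carrier G" using n N.subset by blast
  fix t assume t: "t \<in> T"
  have tG: "t \<in> carrier G" using t subgroup.subset[OF T(1)] by blast
  have "inv t \<otimes> (inv n \<otimes> t \<otimes> n) \<in> M" using n'
  proof
    assume "conj_aut G n ` T \<subseteq> M"
    then have "inv n \<otimes> t \<otimes> n \<in> M" using t tG by (auto simp: conj_aut_apply)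
    then show ?thesis
      using t M subgroup.m_closed[OF M(1)] subgroup.m_inv_closed[OF M(1)] by blast
  qed (use tG in blast)
  then show "inv t \<otimes> (inv n \<otimes> t \<otimes> n) \<in> T" using normal_commutator[OF N n tG] T(2) by blast
qed

text \<open>Subgroups of \<open>M\<close> above \<open>N \<inter> M\<close> fuse under \<open>K\<close> exactly as they do
  under the projection of \<open>K\<close> to \<open>M\<close> along \<open>N\<close>.\<close>

lemma conj_subset_supplement_iff:
  assumes fin: "finite (carrier G)" and K: "subgroup K G" and N: "N \<lhd> G"
    and M: "subgroup M G" "M <#> N = carrier G" and R: "N \<inter> M \<lhd> G"
    and KN: "N \<subseteq> K \<or> (\<forall>n\<in>N. \<forall>g\<in>carrier G. inv g \<otimes> (inv n \<otimes> g \<otimes> n) \<in> M)"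
    and T: "subgroup T G" "N \<inter> M \<subseteq> T" "T \<subseteq> M" and U: "U \<subseteq> M"
  shows "(\<exists>k\<in>K. conj_aut G k ` T \<subseteq> U) \<longleftrightarrow> (\<exists>m\<in>(K <#> N) \<inter> M. conj_aut G m ` T \<subseteq> U)"
proof
  interpret N: normal N G by fact
  assume "\<exists>k\<in>K. conj_aut G k ` T \<subseteq> U"
  then obtain k where k: "k \<in> K" "conj_aut G k ` T \<subseteq> U" by blast
  have kG: "k \<in> carrier G" using k(1) subgroup.subset[OF K] by blast
  then obtain m n where mn: "m \<in> M" "n \<in> N" "k = m \<otimes> n"
    using M(2) unfolding set_mult_def by blast
  have G: "m \<in> carrier G" "n \<in> carrier G" using mn subgroup.subset[OF M(1)] N.subset by auto
  let ?T = "conj_aut G m ` T"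
  have km: "conj_aut G k ` T = conj_aut G n ` ?T"
    using conj_aut_image_mult[OF subgroup.subset[OF T(1)] G] mn(3) by simp
  \<comment> \<open>Since \<open>N \<inter> M\<close> is normal in \<open>G\<close> and
    \<open>m \<in> M\<close>, the conjugate \<open>?T\<close> again lies between
    \<open>N \<inter> M\<close> and \<open>M\<close>; its conjugate by \<open>n\<close> is inside
    \<open>U\<close>, hence inside \<open>M\<close>.\<close>
  have "conj_aut G n ` ?T = ?T"
  proof (rule conj_normal_part_self[OF fin N mn(2) _ _ M(1)])
    show "subgroup ?T G" using subgroup_conj_aut_image[OF G(1) T(1)] .
    show "N \<inter> M \<subseteq> ?T"
      using image_mono[OF T(2), of "conj_aut G m"] normal_conj_aut_image[OF R fin G(1)] by simp
    show "?T \<subseteq> M"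
      using mn(1) T(3) subgroup.subset[OF M(1)] subgroup.m_closed[OF M(1)]
        subgroup.m_inv_closed[OF M(1)] by (auto simp: conj_aut_apply subset_iff)
    show "conj_aut G n ` ?T \<subseteq> M \<or> (\<forall>g\<in>carrier G. inv g \<otimes> (inv n \<otimes> g \<otimes> n) \<in> M)"
      using k(2) km U by auto
  qed
  then have "?T \<subseteq> U" using k(2) km by simp
  moreover have "m = k \<otimes> inv n" using mn(3) G by (simp add: m_assoc)
  then have "m \<in> K <#> N" using k(1) mn(2) N.m_inv_closed unfolding set_mult_def by blast
  ultimately show "\<exists>m\<in>(K <#> N) \<inter> M. conj_aut G m ` T \<subseteq> U" using mn(1) by blast
next
  interpret N: normal N G by fact
  assume "\<exists>m\<in>(K <#> N) \<inter> M. conj_aut G m ` T \<subseteq> U"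
  then obtain m where m: "m \<in> K <#> N" "m \<in> M" "conj_aut G m ` T \<subseteq> U" by blast
  then obtain k n where kn: "k \<in> K" "n \<in> N" "m = k \<otimes> n" by (auto simp: set_mult_def)
  have G: "k \<in> carrier G" "n \<in> carrier G" "m \<in> carrier G"
    using kn m subgroup.subset[OF M(1)] subgroup.subset[OF K] N.subset by auto
  show "\<exists>k\<in>K. conj_aut G k ` T \<subseteq> U"
  proof (cases "N \<subseteq> K")
    case True
    then have "m \<in> K" using kn subgroup.m_closed[OF K] by blast
    then show ?thesis using m(3) by blast
  next
    case False
    \<comment> \<open>In this direction nothing yet places the conjugate of \<open>?T\<close> by
      \<open>inv n\<close> inside \<open>M\<close>, so the commutators with elements of
      \<open>N\<close> have to be in \<open>M\<close> by hypothesis.\<close>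
    then have central: "inv g \<otimes> (inv n' \<otimes> g \<otimes> n') \<in> M" if "n' \<in> N" "g \<in> carrier G" for n' g
      using KN that by blast
    let ?T = "conj_aut G m ` T"
    have "conj_aut G (inv n) ` ?T = ?T"
    proof (rule conj_normal_part_self[OF fin N _ _ _ M(1)])
      show n': "inv n \<in> N" using kn(2) by simp
      show "subgroup ?T G" using subgroup_conj_aut_image[OF G(3) T(1)] .
      show "N \<inter> M \<subseteq> ?T"
        using image_mono[OF T(2), of "conj_aut G m"] normal_conj_aut_image[OF R fin G(3)] by simp
      show "?T \<subseteq> M" using m(3) U by blast
      show "conj_aut G (inv n) ` ?T \<subseteq> M \<or>
          (\<forall>g\<in>carrier G. inv g \<otimes> (inv (inv n) \<otimes> g \<otimes> inv n) \<in> M)"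
        using central[OF n'] by blast
    qed
    moreover have "k = m \<otimes> inv n" using kn(3) G by (simp add: m_assoc)
    then have "conj_aut G k ` T = conj_aut G (inv n) ` ?T"
      using conj_aut_image_mult[OF subgroup.subset[OF T(1)] G(3), of "inv n"] G by simp
    ultimately show ?thesis using m(3) kn(1) by (intro bexI[of _ k]) simp_all
  qed
qed

text \<open>This passes from \<open>G\<close> to the smaller group \<open>M\<close>. The subgroups
  between \<open>N \<inter> M\<close> and \<open>M\<close> represent both intervals, and by
  \<open>conj_subset_supplement_iff\<close> the two orders agree on them.\<close>

lemma mu_supplement:
  assumes fin: "finite (carrier G)" and K: "subgroup K G" and N: "N \<lhd> G"
    and M: "subgroup M G" "M <#> N = carrier G" and R: "N \<inter> M \<lhd> G"
    and KN: "N \<subseteq> K \<or> (\<forall>n\<in>N. \<forall>g\<in>carrier G. inv g \<otimes> (inv n \<otimes> g \<otimes> n) \<in> M)"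
    and H: "subgroup H G" "N \<inter> M \<subseteq> H" "H \<subseteq> M"
  shows "mu (conj_aut G ` K) G H M =
    mu (conj_aut (G\<lparr>carrier := M\<rparr>) ` ((K <#> N) \<inter> M)) (G\<lparr>carrier := M\<rparr>) H M"
proof -
  let ?G = "G\<lparr>carrier := M\<rparr>" and ?L = "(K <#> N) \<inter> M"
  let ?A = "conj_aut G ` K" and ?B = "conj_aut ?G ` ?L"
  define S where "S = {T. subgroup T G \<and> N \<inter> M \<subseteq> T \<and> T \<subseteq> M}"
  interpret G': group ?G by (rule subgroup_imp_group[OF M(1)])
  have fin': "finite (carrier ?G)" using finite_subset[OF subgroup.subset[OF M(1)] fin] by simp
  have "subgroup ?L ?G"
    using subgroup_incl[OF subgroups_Inter_pair[OF set_mult_normal_subgroup[OF K N] M(1)] M(1)]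
    by simp
  then have B: "subgroup ?B (AutoGroup ?G)" by (rule G'.subgroup_conj_aut)
  have A: "subgroup ?A (AutoGroup G)" by (rule subgroup_conj_aut[OF K])
  note leA = class_poset_le_iff[OF A] and leB = G'.class_poset_le_iff[OF B]
  have KG: "k \<in> carrier G" if "k \<in> K" for k using that subgroup.subset[OF K] by blast
  have S': "subgroup T ?G" if "T \<in> S" for T using subgroup_incl[OF _ M(1)] that by (simp add: S_def)
  have clA: "aut_class ?A T \<in> carrier (class_poset ?A G)" if "T \<in> S" for T
    using that by (auto simp: class_poset_def S_def)
  have clB: "aut_class ?B T \<in> carrier (class_poset ?B ?G)" if "T \<in> S" for T
    using S'[OF that] by (auto simp: class_poset_def)
  have img: "conj_aut ?G m ` T = conj_aut G m ` T" if "m \<in> ?L" "T \<subseteq> M" for m T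
    using conj_aut_restrict_image[OF M(1)] that by simp
  have "moebius (class_poset ?A G) (aut_class ?A H) (aut_class ?A M) =
    moebius (class_poset ?B ?G) (aut_class ?B H) (aut_class ?B M)"
  proof (rule moebius_interval_cong[where S = S])
    show "partial_order (class_poset ?A G)" by (rule partial_order_class_poset[OF A fin])
    show "finite (carrier (class_poset ?A G))" by (rule finite_class_poset[OF fin])
    show "partial_order (class_poset ?B ?G)" by (rule G'.partial_order_class_poset[OF B fin'])
    show "finite (carrier (class_poset ?B ?G))" by (rule G'.finite_class_poset[OF fin'])
    show "aut_class ?A ` S \<subseteq> carrier (class_poset ?A G)" using clA by blast
    show "aut_class ?B ` S \<subseteq> carrier (class_poset ?B ?G)" using clB by blast
    show "H \<in> S" "M \<in> S" using H M by (auto simp: S_def)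
  next
    fix T U assume TU: "T \<in> S" "U \<in> S"
    then have "(\<exists>k\<in>K. conj_aut G k ` T \<subseteq> U) \<longleftrightarrow> (\<exists>m\<in>?L. conj_aut G m ` T \<subseteq> U)"
      by (intro conj_subset_supplement_iff[OF fin K N M R KN]) (auto simp: S_def)
    also have "\<dots> \<longleftrightarrow> (\<exists>m\<in>?L. conj_aut ?G m ` T \<subseteq> U)"
      using img TU by (auto simp: S_def)
    finally show "aut_class ?A T \<sqsubseteq>\<^bsub>class_poset ?A G\<^esub> aut_class ?A U \<longleftrightarrow>
        aut_class ?B T \<sqsubseteq>\<^bsub>class_poset ?B ?G\<^esub> aut_class ?B U"
      using leA leB[OF S' S'] TU by (simp add: S_def)
  next
    fix z assume z: "z \<in> carrier (class_poset ?A G)"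
      "aut_class ?A H \<sqsubseteq>\<^bsub>class_poset ?A G\<^esub> z" "z \<sqsubseteq>\<^bsub>class_poset ?A G\<^esub> aut_class ?A M"
    obtain T where T: "subgroup T G" "z = aut_class ?A T" using z(1) by (auto simp: class_poset_def)
    obtain k where k: "k \<in> K" "conj_aut G k ` T \<subseteq> M" using z(3) leA[OF T(1) M(1)] T by auto
    let ?T = "conj_aut G k ` T"
    have T': "subgroup ?T G" using subgroup_conj_aut_image[OF KG[OF k(1)] T(1)] .
    have zT: "z = aut_class ?A ?T"
      using aut_class_eq[OF A subgroup.subset[OF T(1)]] k(1) T by simp
    then obtain h where h: "h \<in> K" "conj_aut G h ` H \<subseteq> ?T" using z(2) leA[OF H(1) T'] by auto
    \<comment> \<open>\<open>N \<inter> M\<close> is contained in \<open>H\<close> and invariant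
      under conjugation, so it is contained in every conjugate of \<open>H\<close>, in particular in
      the one inside \<open>?T\<close>.\<close>
    have "N \<inter> M \<subseteq> ?T"
      using image_mono[OF H(2), of "conj_aut G h"] h normal_conj_aut_image[OF R fin KG[OF h(1)]]
      by auto
    then show "z \<in> aut_class ?A ` S" using zT T' k(2) by (auto simp: S_def)
  next
    fix z assume z: "z \<in> carrier (class_poset ?B ?G)"
      "aut_class ?B H \<sqsubseteq>\<^bsub>class_poset ?B ?G\<^esub> z"
    obtain T where T: "subgroup T ?G" "z = aut_class ?B T" using z(1) by (auto simp: class_poset_def)
    have H': "subgroup H ?G" using subgroup_incl[OF H(1) M(1) H(3)] .
    obtain m where m: "m \<in> ?L" "conj_aut ?G m ` H \<subseteq> T" using z(2) leB[OF H' T(1)] T by auto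
    have mG: "m \<in> carrier G" using m(1) subgroup.subset[OF M(1)] by blast
    have "N \<inter> M \<subseteq> T"
      using image_mono[OF H(2), of "conj_aut G m"] m img[OF m(1) H(3)]
        normal_conj_aut_image[OF R fin mG] by auto
    moreover have "subgroup T G" "T \<subseteq> M"
      using incl_subgroup[OF M(1) T(1)] subgroup.subset[OF T(1)] by auto
    ultimately show "z \<in> aut_class ?B ` S" using T(2) by (auto simp: S_def)
  qed
  then show ?thesis by (simp add: mu_def)
qed

text \<open>Write \<open>g = m \<otimes> n\<close>. For \<open>x\<close> in
  \<open>N \<inter> M\<close>, conjugation by \<open>n\<close> multiplies \<open>x\<close> by a
  commutator from the derived subgroup of \<open>N\<close>, so the result stays in \<open>M\<close>;
  conjugation by \<open>m\<close> preserves \<open>M\<close>. Normality of \<open>N\<close> does the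
  rest.\<close>

lemma supplement_Int_normal:
  assumes N: "N \<lhd> G" and M: "subgroup M G" "M <#> N = carrier G" and der: "derived G N \<subseteq> M"
  shows "N \<inter> M \<lhd> G"
proof (rule normal_invI)
  interpret N: normal N G by fact
  interpret M: subgroup M G by fact
  show "subgroup (N \<inter> M) G" by (rule subgroups_Inter_pair[OF N.subgroup_axioms M(1)])
  fix g x assume g: "g \<in> carrier G" and x: "x \<in> N \<inter> M"
  obtain m n where mn: "m \<in> M" "n \<in> N" "g = m \<otimes> n" using g M(2) unfolding set_mult_def by blast
  have G: "m \<in> carrier G" "n \<in> carrier G" "x \<in> carrier G" using mn x by auto
  have "n \<otimes> x \<otimes> inv n \<otimes> inv x \<in> derived G N"
    unfolding derived_def using mn(2) x by (intro generate.incl) auto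
  then have "n \<otimes> x \<otimes> inv n \<otimes> inv x \<otimes> x \<in> M" using der x by blast
  then have "n \<otimes> x \<otimes> inv n \<in> M" using G by (simp add: m_assoc)
  then have "m \<otimes> (n \<otimes> x \<otimes> inv n) \<otimes> inv m \<in> M" using mn(1) by blast
  moreover have "m \<otimes> (n \<otimes> x \<otimes> inv n) \<otimes> inv m = g \<otimes> x \<otimes> inv g"
    using G mn(3) by (simp add: m_assoc inv_mult_group)
  moreover have "g \<otimes> x \<otimes> inv g \<in> N" using N.inv_op_closed2 g x by blast
  ultimately show "g \<otimes> x \<otimes> inv g \<in> N \<inter> M" by simp
qed

section \<open>Choice of the normal subgroup in a solvable group\<close>

text \<open>Take \<open>N\<close> of least order among the normal subgroups inside \<open>D\<close>
  not contained in \<open>H\<close>; a proper subgroup of it has smaller order.\<close>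

lemma exists_minimal_normal_not_subset:
  assumes fin: "finite (carrier G)" and D: "D \<lhd> G" "\<not> D \<subseteq> H"
  obtains N where "N \<lhd> G" "N \<subseteq> D" "\<not> N \<subseteq> H"
    "\<And>L. L \<lhd> G \<Longrightarrow> L \<subseteq> N \<Longrightarrow> L \<noteq> N \<Longrightarrow> L \<subseteq> H"
proof -
  let ?X = "\<lambda>N. N \<lhd> G \<and> N \<subseteq> D \<and> \<not> N \<subseteq> H"
  obtain N where N: "?X N" and min: "\<And>L. ?X L \<Longrightarrow> card N \<le> card L"
    using ex_has_least_nat[of ?X D card] D by auto
  have "finite N" using N fin subgroup.subset[OF normal_imp_subgroup] finite_subset by metis
  then have "L \<subseteq> H" if "L \<lhd> G" "L \<subseteq> N" "L \<noteq> N" for L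
    using that min[of L] N card_seteq[of N L] by blast
  then show ?thesis using N that by blast
qed

text \<open>The derived series starts outside \<open>H\<close> and ends with the trivial group
  inside \<open>H\<close>, so some step enters \<open>H\<close>.\<close>

lemma solvable_derived_series_step:
  assumes solv: "solvable G" and H: "subgroup H G" "H \<noteq> carrier G"
  obtains D where "D \<lhd> G" "\<not> D \<subseteq> H" "derived G D \<subseteq> H"
proof -
  let ?D = "\<lambda>n. (derived G ^^ n) (carrier G)"
  have D: "?D n \<lhd> G" for n
    by (induction n) (simp_all add: normal_self derived_is_normal)
  obtain n where "?D n = {\<one>}" using solv solvable_iff_trivial_derived_seq by auto
  then have n: "?D n \<subseteq> H" using subgroup.one_closed[OF H(1)] by simp
  have "\<not> ?D 0 \<subseteq> H" using H subgroup.subset by auto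
  then obtain i where "\<not> ?D i \<subseteq> H" "?D (Suc i) \<subseteq> H"
    using n by (induction n) blast+
  then show ?thesis using that[OF D] by simp
qed

lemma solvable_restrict:
  assumes "solvable G" "subgroup M G"
  shows "solvable (G\<lparr>carrier := M\<rparr>)"
proof -
  interpret G': group "G\<lparr>carrier := M\<rparr>" by (rule subgroup_imp_group[OF assms(2)])
  have "group_hom (G\<lparr>carrier := M\<rparr>) G (\<lambda>x. x)"
    by unfold_locales (use subgroup.subset[OF assms(2)] in \<open>auto simp: hom_def\<close>)
  then show ?thesis by (rule group_hom.inj_hom_imp_solvable) (use assms in auto)
qed

section \<open>Induction on the order of the group\<close>

lemma lam_eq_mu_step:
  assumes fin: "finite (carrier G)" and solv: "solvable G"
    and K: "subgroup K G" and dK: "derived G (carrier G) \<subseteq> K" and H: "subgroup H G"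
    and IH: "\<And>M L. subgroup M G \<Longrightarrow> M \<noteq> carrier G \<Longrightarrow> H \<subseteq> M \<Longrightarrow>
      subgroup L (G\<lparr>carrier := M\<rparr>) \<Longrightarrow> derived G M \<subseteq> L \<Longrightarrow>
      lam (G\<lparr>carrier := M\<rparr>) H M =
        mu (conj_aut (G\<lparr>carrier := M\<rparr>) ` L) (G\<lparr>carrier := M\<rparr>) H M"
  shows "lam G H (carrier G) = mu (conj_aut G ` K) G H (carrier G)"
proof -
  note G = subgroup_self
  have Inn: "Inn G = conj_aut G ` carrier G" by (simp add: Inn_def)
  note AutK = subgroup_conj_aut[OF K] and AutG = subgroup_conj_aut[OF G]
  show ?thesis
  proof (cases "H = carrier G")
    case True
    have "mu A G H H = 1" if "subgroup A (AutoGroup G)" for A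
      unfolding mu_def
      by (rule moebius_refl[OF partial_order_class_poset[OF that fin] finite_class_poset[OF fin]])
        (use H in \<open>auto simp: class_poset_def\<close>)
    then show ?thesis using AutK AutG True by (simp add: lam_def Inn)
  next
    case False
    obtain D where D: "D \<lhd> G" "\<not> D \<subseteq> H" "derived G D \<subseteq> H"
      using solvable_derived_series_step[OF solv H False] .
    obtain N where N: "N \<lhd> G" "N \<subseteq> D" "\<not> N \<subseteq> H"
      and min: "\<And>L. L \<lhd> G \<Longrightarrow> L \<subseteq> N \<Longrightarrow> L \<noteq> N \<Longrightarrow> L \<subseteq> H"
      using exists_minimal_normal_not_subset[OF fin D(1,2)] by metis
    interpret N: normal N G by (rule N(1))
    have derN: "derived G N \<subseteq> H" using mono_derived[OF N(2)] D(3) by blast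
    define S where "S = {M. subgroup M G \<and> H \<subseteq> M \<and> M \<noteq> carrier G \<and> M <#> N = carrier G}"
    have R: "N \<inter> M \<lhd> G" "N \<inter> M \<subseteq> H" if "M \<in> S" for M
    proof -
      have M: "subgroup M G" "H \<subseteq> M" "M \<noteq> carrier G" "M <#> N = carrier G"
        using that by (auto simp: S_def)
      show *: "N \<inter> M \<lhd> G" using supplement_Int_normal[OF N(1) M(1,4)] derN M(2) by blast
      \<comment> \<open>Otherwise \<open>M <#> N\<close> would be \<open>M\<close>, a proper
        subgroup. So \<open>N \<inter> M\<close> is a proper part of \<open>N\<close> and minimality
        applies.\<close>
      have "\<not> N \<subseteq> M"
        using M(3,4) set_mult_subgroup_idem[OF M(1) subgroup_incl[OF N.subgroup_axioms M(1)]] by auto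
      then show "N \<inter> M \<subseteq> H" using min[OF *] by blast
    qed
    \<comment> \<open>If \<open>N\<close> is not inside the derived subgroup, its intersection with
      it is a smaller normal subgroup, hence inside \<open>H\<close>, and it contains all
      commutators \<open>[g, n]\<close>.\<close>
    have KN: "N \<subseteq> K \<or> (\<forall>n\<in>N. \<forall>g\<in>carrier G. inv g \<otimes> (inv n \<otimes> g \<otimes> n) \<in> H)"
    proof (cases "N \<subseteq> derived G (carrier G)")
      case False
      have "N \<inter> derived G (carrier G) \<lhd> G"
        by (rule normal_subgroup_intersect[OF N(1) derived_self_is_normal])
      then have *: "N \<inter> derived G (carrier G) \<subseteq> H" using min False by blast
      have "inv g \<otimes> (inv n \<otimes> g \<otimes> n) \<in> H" if n: "n \<in> N" and g: "g \<in> carrier G" for n g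
      proof -
        have "inv g \<otimes> inv n \<otimes> inv (inv g) \<otimes> inv (inv n) \<in> derived G (carrier G)"
          unfolding derived_def
          by (rule generate.incl, rule UN_I[of "inv g"], use g in simp, rule UN_I[of "inv n"])
            (use n in auto)
        then have "inv g \<otimes> (inv n \<otimes> g \<otimes> n) \<in> derived G (carrier G)"
          using n g by (simp add: m_assoc)
        then show ?thesis using normal_commutator[OF N(1) n g] * by blast
      qed
      then show ?thesis by blast
    qed (use dK in blast)
    \<comment> \<open>Applied with \<open>L = K\<close> and with \<open>L = carrier G\<close>: both
      values equal the same \<open>lam\<close> in \<open>M\<close>, so the summands agree.\<close>
    have mu_M: "mu (conj_aut G ` L) G H M = lam (G\<lparr>carrier := M\<rparr>) H M"
      if M: "M \<in> S" and L: "subgroup L G" "derived G (carrier G) \<subseteq> L" "K \<subseteq> L" for M L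
    proof -
      have M': "subgroup M G" "H \<subseteq> M" "M \<noteq> carrier G" "M <#> N = carrier G"
        using M by (auto simp: S_def)
      have sub: "M \<subseteq> carrier G" by (rule subgroup.subset[OF M'(1)])
      have LNM: "subgroup ((L <#> N) \<inter> M) (G\<lparr>carrier := M\<rparr>)"
        using subgroup_incl[OF subgroups_Inter_pair[OF set_mult_normal_subgroup[OF L(1) N(1)] M'(1)] M'(1)]
        by simp
      have d: "derived G M \<subseteq> (L <#> N) \<inter> M"
        using mono_derived[OF sub] L(2) subset_set_mult(1)[OF L(1) N.subgroup_axioms]
          derived_incl[OF order.refl M'(1)] by blast
      have "mu (conj_aut G ` L) G H M =
          mu (conj_aut (G\<lparr>carrier := M\<rparr>) ` ((L <#> N) \<inter> M)) (G\<lparr>carrier := M\<rparr>) H M"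
        by (rule mu_supplement[OF fin L(1) N(1) M'(1,4) R(1)[OF M] _ H R(2)[OF M] M'(2)])
          (use KN L(3) M'(2) in blast)
      also have "\<dots> = lam (G\<lparr>carrier := M\<rparr>) H M"
        using IH[OF M'(1,3,2) LNM d] by simp
      finally show ?thesis .
    qed
    have K_sub: "K \<subseteq> carrier G" by (rule subgroup.subset[OF K])
    \<comment> \<open>Only fusion under \<open>G\<close> has to be brought down to \<open>K\<close>.
      With \<open>g = m \<otimes> n\<close> the factor \<open>m\<close> fixes \<open>M\<close>, so
      \<open>n\<close> alone carries \<open>M\<close> to \<open>M'\<close>. Either \<open>n\<close>
      is in \<open>K\<close>, or \<open>n\<close> fixes \<open>M\<close> as well and
      \<open>\<one>\<close> serves as the witness.\<close>
    have fuse: "aut_class (conj_aut G ` carrier G) M = aut_class (conj_aut G ` carrier G) M' \<longleftrightarrow>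
        aut_class (conj_aut G ` K) M = aut_class (conj_aut G ` K) M'"
      if M: "M \<in> S" and M': "M' \<in> S" for M M'
    proof -
      have Ms: "subgroup M G" "H \<subseteq> M" "M <#> N = carrier G" using M by (auto simp: S_def)
      have sub: "M \<subseteq> carrier G" "M' \<subseteq> carrier G"
        using M M' subgroup.subset by (auto simp: S_def)
      have "\<exists>k\<in>K. conj_aut G k ` M = M'" if g: "g \<in> carrier G" "conj_aut G g ` M = M'" for g
      proof -
        obtain m n where mn: "m \<in> M" "n \<in> N" "g = m \<otimes> n"
          using g(1) Ms(3) unfolding set_mult_def by blast
        have G: "m \<in> carrier G" "n \<in> carrier G" using mn sub by auto
        have "conj_aut G m ` M = M"
          by (rule conj_aut_image_self[OF Ms(1) fin G(1)])
            (use mn(1) subgroup.m_closed[OF Ms(1)] subgroup.m_inv_closed[OF Ms(1)] in blast)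
        then have n: "conj_aut G n ` M = M'"
          using conj_aut_image_mult[OF sub(1) G] mn(3) g(2) by simp
        show ?thesis
        proof (cases "N \<subseteq> K")
          case False
          then have "conj_aut G n ` M = M"
            by (intro conj_normal_part_self[OF fin N(1) mn(2) Ms(1) _ Ms(1)])
              (use R[OF M] KN Ms(2) mn(2) in blast)+
          moreover have "conj_aut G \<one> ` M = M"
            by (rule conj_aut_image_self[OF Ms(1) fin]) (use sub subgroup.one_closed[OF Ms(1)] in auto)
          ultimately show ?thesis using n subgroup.one_closed[OF K] by auto
        qed (use n mn(2) in blast)
      qed
      then show ?thesis
        unfolding aut_class_eq_iff[OF AutK sub] aut_class_eq_iff[OF AutG sub] using K_sub by blast
    qed
    have "lam G H (carrier G) = - (\<Sum>z \<in> aut_class (conj_aut G ` carrier G) ` S.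
        moebius (class_poset (conj_aut G ` carrier G) G) (aut_class (conj_aut G ` carrier G) H) z)"
      unfolding lam_def Inn S_def by (rule sum_mu_supplements[OF fin G N(1) H N(3) HOL.refl])
    also have "\<dots> = - (\<Sum>z \<in> aut_class (conj_aut G ` K) ` S.
        moebius (class_poset (conj_aut G ` K) G) (aut_class (conj_aut G ` K) H) z)"
      by (rule arg_cong[OF sum_image_eq])
        (use fuse mu_M[OF _ K dK] mu_M[OF _ G derived_in_carrier K_sub] in \<open>simp_all add: mu_def\<close>)
    also have "\<dots> = mu (conj_aut G ` K) G H (carrier G)"
      unfolding S_def by (rule sum_mu_supplements[OF fin K N(1) H N(3) HOL.refl, symmetric])
    finally show ?thesis .
  qed
qed

end

text \<open>Both the group and \<open>K\<close> vary in the induction, since the step passes to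
  \<open>M\<close> with a new subgroup \<open>L\<close> in place of \<open>K\<close>;
  \<open>H\<close> stays fixed.\<close>

lemma lam_eq_mu:
  assumes "group G" "finite (carrier G)" "solvable G"
    and "subgroup K G" "derived G (carrier G) \<subseteq> K" "subgroup H G"
  shows "lam G H (carrier G) = mu (conj_aut G ` K) G H (carrier G)"
  using assms
proof (induction "card (carrier G)" arbitrary: G K rule: less_induct)
  case (less G K)
  interpret group G by fact
  show ?case
  proof (rule lam_eq_mu_step[OF less.prems(2-6)])
    fix M L
    let ?G = "G\<lparr>carrier := M\<rparr>"
    assume M: "subgroup M G" "M \<noteq> carrier G" "H \<subseteq> M"
      and L: "subgroup L ?G" "derived G M \<subseteq> L"
    have sub: "M \<subset> carrier G" using subgroup.subset[OF M(1)] M(2) by blast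
    have "lam ?G H (carrier ?G) = mu (conj_aut ?G ` L) ?G H (carrier ?G)"
    proof (rule less.hyps[OF _ subgroup_imp_group[OF M(1)] _ solvable_restrict[OF less.prems(3) M(1)]
          L(1) _ subgroup_incl[OF less.prems(6) M(1,3)]])
      show "card (carrier ?G) < card (carrier G)"
        using psubset_card_mono[OF less.prems(2) sub] by simp
      show "finite (carrier ?G)" using finite_subset[OF _ less.prems(2)] sub by auto
      show "derived ?G (carrier ?G) \<subseteq> L" using derived_consistent[OF order.refl M(1)] L(2) by simp
    qed
    then show "lam ?G H M = mu (conj_aut ?G ` L) ?G H M" by simp
  qed
qed

theorem proposition1:
  fixes G :: "('a, 'b) monoid_scheme" (structure)
    and K H :: "'a set"
    and A :: "('a \<Rightarrow> 'a) set"
  assumes "group G"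
    and "finite (carrier G)"
    and "solvable G"
    and "subgroup K G"
    and "derived G (carrier G) \<subseteq> K"
    and "A = conj_aut G ` K"
    and "subgroup H G"
  shows "lam G H (carrier G) = mu A G H (carrier G)"
  using lam_eq_mu[OF assms(1-5,7)] assms(6) by simp

end
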